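(* For every pair of circularly ordered sets $X,Y$, the set $M_+(X,Y)$ of all circular order preserving (COP) maps $X\to Y$ is pointwise closed in $Y^X$, i.e. closed in the product topology on $Y^X$, where $Y$ carries its interval topology.
   Context: A circular order on a set $X$ is a ternary relation $R\subseteq X^3$ (write $[a,b,c]$ for $(a,b,c)\in R$) satisfying: cyclicity ($[a,b,c]\Rightarrow[b,c,a]$); asymmetry ($[a,b,c]\Rightarrow (c,b,a)\notin R$); transitivity ($[a,b,c]$ and $[a,c,d]$ imply $[a,b,d]$); totality (if $a,b,c$ are distinct then $[a,b,c]$ or $[a,c,b]$). Put $(a,b)_R:=\{x\in X:[a,x,b]\}$ and $[a,b]_R:=(a,b)_R\cup\{a,b\}$. The interval topology $\lambda_R$ is the topology on $X$ with base $\{X\setminus[a,b]_R: a,b\in X\}\cup\{X\}$. A map $f:X_1\to X_2$ of circularly ordered sets is COP (circular order preserving) if: (COP1) whenever $[a,b,c]$ in $X_1$ and $f(a),f(b),f(c)$ are pairwise distinct, then $[f(a),f(b),f(c)]$ in $X_2$; (COP2) if $f(x)=f(y)$ then $f$ is constant on one of the closed intervals $[x,y]$, $[y,x]$. *)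

theory Defs
  imports "HOL-Analysis.Analysis"
begin

definition circular_order_on :: "'a set \<Rightarrow> ('a \<times> 'a \<times> 'a) set \<Rightarrow> bool" where
  "circular_order_on X R \<longleftrightarrow>
     R \<subseteq> X \<times> X \<times> X \<and>
     (\<forall>a b c. (a, b, c) \<in> R \<longrightarrow> (b, c, a) \<in> R) \<and>
     (\<forall>a b c. (a, b, c) \<in> R \<longrightarrow> (c, b, a) \<notin> R) \<and>
     (\<forall>a b c d. (a, b, c) \<in> R \<and> (a, c, d) \<in> R \<longrightarrow> (a, b, d) \<in> R) \<and>
     (\<forall>a\<in>X. \<forall>b\<in>X. \<forall>c\<in>X. a \<noteq> b \<and> b \<noteq> c \<and> a \<noteq> c \<longrightarrow> (a, b, c) \<in> R \<or> (a, c, b) \<in> R)"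

definition circ_open_interval :: "'a set \<Rightarrow> ('a \<times> 'a \<times> 'a) set \<Rightarrow> 'a \<Rightarrow> 'a \<Rightarrow> 'a set" where
  "circ_open_interval X R a b = {x \<in> X. (a, x, b) \<in> R}"

definition circ_closed_interval :: "'a set \<Rightarrow> ('a \<times> 'a \<times> 'a) set \<Rightarrow> 'a \<Rightarrow> 'a \<Rightarrow> 'a set" where
  "circ_closed_interval X R a b = circ_open_interval X R a b \<union> {a, b}"

definition circ_base :: "'a set \<Rightarrow> ('a \<times> 'a \<times> 'a) set \<Rightarrow> 'a set set" where
  "circ_base X R = {X - circ_closed_interval X R a b | a b. a \<in> X \<and> b \<in> X} \<union> {X}"

text \<open>The open sets are the unions of members of \<open>circ_base X R\<close>; that these form a topology
  is shown in \<open>openin_circ_topology\<close> below.\<close>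

definition circ_topology :: "'a set \<Rightarrow> ('a \<times> 'a \<times> 'a) set \<Rightarrow> 'a topology" where
  "circ_topology X R = topology (arbitrary union_of (\<lambda>U. U \<in> circ_base X R))"

text \<open>Maps \<open>X \<rightarrow> Y\<close> are elements of \<open>X \<rightarrow>\<^sub>E Y\<close>, that is, they are \<open>undefined\<close> outside \<open>X\<close>, as are the
  points of the library's product topology.\<close>

definition COP_maps ::
  "'a set \<Rightarrow> ('a \<times> 'a \<times> 'a) set \<Rightarrow> 'b set \<Rightarrow> ('b \<times> 'b \<times> 'b) set \<Rightarrow> ('a \<Rightarrow> 'b) set" where
  "COP_maps X R Y S = {f \<in> X \<rightarrow>\<^sub>E Y.
     (\<forall>a b c. (a, b, c) \<in> R \<and> f a \<noteq> f b \<and> f b \<noteq> f c \<and> f a \<noteq> f c \<longrightarrow> (f a, f b, f c) \<in> S) \<and>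
     (\<forall>x\<in>X. \<forall>y\<in>X. f x = f y \<longrightarrow>
        f constant_on circ_closed_interval X R x y \<or> f constant_on circ_closed_interval X R y x)}"

lemma circ_base_inter:
  assumes R: "circular_order_on X R" and U: "U \<in> circ_base X R" and V: "V \<in> circ_base X R"
    and x: "x \<in> U" "x \<in> V"
  shows "\<exists>W \<in> circ_base X R. x \<in> W \<and> W \<subseteq> U \<inter> V"
proof (cases "U = X \<or> V = X")
  case True
  have "U \<subseteq> X" "V \<subseteq> X"
    using U V by (auto simp: circ_base_def)
  then show ?thesis
    using True U V x by auto
next
  case False
  let ?I = "circ_closed_interval X R"
  obtain a b c d where ab: "a \<in> X" "b \<in> X" "U = X - ?I a b" and cd: "c \<in> X" "d \<in> X" "V = X - ?I c d"
    using False U V by (auto simp: circ_base_def)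
  have xX: "x \<in> X" and xn: "x \<notin> ?I a b" "x \<notin> ?I c d"
    using x ab cd by auto
  note ax = R[unfolded circular_order_on_def]
  note cyc = ax[THEN conjunct2, THEN conjunct1, rule_format]
  note asy = ax[THEN conjunct2, THEN conjunct2, THEN conjunct1, rule_format]
  have tr: "(a, b, d) \<in> R" if "(a, b, c) \<in> R" "(a, c, d) \<in> R" for a b c d
    using ax[THEN conjunct2, THEN conjunct2, THEN conjunct2, THEN conjunct1] that by metis
  have tot: "(a, b, c) \<in> R \<or> (a, c, b) \<in> R"
    if "a \<in> X" "b \<in> X" "c \<in> X" "a \<noteq> b" "b \<noteq> c" "a \<noteq> c" for a b c
    using ax[THEN conjunct2, THEN conjunct2, THEN conjunct2, THEN conjunct2] that by metis
  define le where "le u v \<longleftrightarrow> u = v \<or> (x, u, v) \<in> R" for u v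
  have le_tr: "le u v \<Longrightarrow> le v w \<Longrightarrow> le u w" for u v w
    unfolding le_def using tr by metis
  have le_tot: "le u v \<or> le v u" if "u \<in> X" "v \<in> X" "u \<noteq> x" "v \<noteq> x" for u v
    unfolding le_def using tot xX that by metis
  have key: "le p q \<and> (\<forall>z. z \<in> ?I p q \<longrightarrow> le p z \<and> le z q)"
    if "p \<in> X" "q \<in> X" "x \<notin> ?I p q" for p q
  proof -
    have ne: "p \<noteq> x" "q \<noteq> x" "(p, x, q) \<notin> R"
      using that xX by (auto simp: circ_closed_interval_def circ_open_interval_def)
    then have pq: "le p q"
      unfolding le_def using tot[OF \<open>p \<in> X\<close> \<open>q \<in> X\<close> xX] cyc by metis
    moreover have "le p z \<and> le z q" if z: "(p, z, q) \<in> R" for z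
    proof -
      have "p \<noteq> q"
        using z asy cyc by metis
      then have 1: "(x, p, q) \<in> R"
        using pq by (simp add: le_def)
      have "(p, z, x) \<in> R"
        using tr[OF z] 1 cyc by metis
      moreover have "(q, x, z) \<in> R"
        using tr[of q x p z] 1 z cyc by metis
      ultimately show ?thesis
        unfolding le_def using cyc by metis
    qed
    ultimately show ?thesis
      by (auto simp: circ_closed_interval_def circ_open_interval_def le_def)
  qed
  have conv: "x \<notin> ?I e f \<and> (\<forall>z. z \<in> X \<and> le e z \<and> le z f \<longrightarrow> z \<in> ?I e f)"
    if ef: "e \<in> X" "f \<in> X" "e \<noteq> x" "f \<noteq> x" "le e f" for e f
  proof -
    have "(e, x, f) \<notin> R"
      using ef asy cyc unfolding le_def by metis
    moreover have "z = e \<or> z = f \<or> (e, z, f) \<in> R" if "le e z" "le z f" for z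
    proof (cases "z = e \<or> z = f")
      case False
      then have "(x, e, z) \<in> R" "(x, z, f) \<in> R"
        using that by (auto simp: le_def)
      then have "(z, f, e) \<in> R"
        using tr[of z f x e] cyc by metis
      then show ?thesis
        using cyc by metis
    qed auto
    ultimately show ?thesis
      using ef by (auto simp: circ_closed_interval_def circ_open_interval_def)
  qed
  have ne: "a \<noteq> x" "b \<noteq> x" "c \<noteq> x" "d \<noteq> x"
    using xn by (auto simp: circ_closed_interval_def)
  obtain e where e: "e \<in> X" "e \<noteq> x" "le e a" "le e c"
    using le_tot[of a c] ab cd ne le_def by metis
  obtain f where f: "f \<in> X" "f \<noteq> x" "le b f" "le d f"
    using le_tot[of b d] ab cd ne le_def by metis
  have kab: "le a b" "\<And>z. z \<in> ?I a b \<Longrightarrow> le a z \<and> le z b"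
    and kcd: "\<And>z. z \<in> ?I c d \<Longrightarrow> le c z \<and> le z d"
    using key ab cd xn by blast+
  have "le e f"
    using le_tr e(3) f(3) kab(1) by metis
  then have ef: "x \<notin> ?I e f" "\<And>z. z \<in> X \<Longrightarrow> le e z \<Longrightarrow> le z f \<Longrightarrow> z \<in> ?I e f"
    using conv e f by blast+
  have "z \<in> ?I e f" if "z \<in> ?I a b \<union> ?I c d" "z \<in> X" for z
    using that ef(2) kab(2) kcd le_tr e f by (metis Un_iff)
  then have "X - ?I e f \<subseteq> U \<inter> V"
    using ab cd by blast
  moreover have "X - ?I e f \<in> circ_base X R"
    using e f by (auto simp: circ_base_def)
  ultimately show ?thesis
    using ef(1) xX by blast
qed

lemma openin_circ_topology:
  assumes "circular_order_on X R"
  shows "openin (circ_topology X R) = arbitrary union_of (\<lambda>U. U \<in> circ_base X R)"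
proof -
  have "(arbitrary union_of (\<lambda>U. U \<in> circ_base X R)) (U \<inter> V)"
    if "U \<in> circ_base X R" "V \<in> circ_base X R" for U V
  proof -
    have "U \<inter> V = \<Union>{W \<in> circ_base X R. W \<subseteq> U \<inter> V}"
      using circ_base_inter[OF assms that] by blast
    then show ?thesis
      unfolding union_of_def arbitrary_def by (metis (no_types, lifting) mem_Collect_eq subsetI)
  qed
  then have "istopology (arbitrary union_of (\<lambda>U. U \<in> circ_base X R))"
    unfolding istopology_base_eq by blast
  then show ?thesis
    unfolding circ_topology_def by (rule topology_inverse')
qed

lemma topspace_circ_topology:
  assumes "circular_order_on X R"
  shows "topspace (circ_topology X R) = X"
proof
  have "V \<subseteq> X" if "V \<in> circ_base X R" for V
    using that by (auto simp: circ_base_def)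
  then show "topspace (circ_topology X R) \<subseteq> X"
    using openin_topspace[of "circ_topology X R"]
    unfolding openin_circ_topology[OF assms] union_of_def by blast
  have "openin (circ_topology X R) X"
    unfolding openin_circ_topology[OF assms] by (rule arbitrary_union_of_inc) (simp add: circ_base_def)
  then show "X \<subseteq> topspace (circ_topology X R)"
    by (rule openin_subset)
qed

end

(* The complement of the set of COP maps is open.  A failure of COP1 is an inverted triple of
   distinct values, and the circular order is an open relation for its interval topology.  A failure
   of COP2 at f x = f y = p is witnessed by points z, w in the two arcs between x and y with values
   q, r different from p.  If g is close to f, then either g x = g y, and z, w again witness a
   failure of COP2, or COP1 would force g z, g w to lie in different arcs between g x and g y;
   this is impossible when g x, g y are close to p and g z, g w are close to q, r. *)
theory Submission
  imports Defs
begin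

section \<open>Circular orders: consequences of the axioms\<close>

locale circular_order =
  fixes Y :: "'b set" and S :: "('b \<times> 'b \<times> 'b) set"
  assumes circular_order: "circular_order_on Y S"
begin

lemmas axioms = circular_order[unfolded circular_order_on_def]

lemma in_carrier: "(a, b, c) \<in> S \<Longrightarrow> a \<in> Y \<and> b \<in> Y \<and> c \<in> Y"
  using axioms[THEN conjunct1] by auto

lemma cyclic: "(a, b, c) \<in> S \<Longrightarrow> (b, c, a) \<in> S"
  using axioms[THEN conjunct2, THEN conjunct1, rule_format] .

lemma asymmetric: "(a, b, c) \<in> S \<Longrightarrow> (c, b, a) \<notin> S"
  using axioms[THEN conjunct2, THEN conjunct2, THEN conjunct1, rule_format] .

lemma transitive: "(a, b, c) \<in> S \<Longrightarrow> (a, c, d) \<in> S \<Longrightarrow> (a, b, d) \<in> S"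
  using axioms[THEN conjunct2, THEN conjunct2, THEN conjunct2, THEN conjunct1, rule_format, OF conjI] .

lemma cyclic': "(a, b, c) \<in> S \<Longrightarrow> (c, a, b) \<in> S"
  by (rule cyclic[OF cyclic])

text \<open>The hypotheses place \<open>a\<close>, \<open>b\<close>, \<open>c\<close>,
  \<open>d\<close> in this cyclic order. While \<open>transitive\<close> drops \<open>c\<close>,
  this form drops \<open>a\<close>; it is transitivity with base point \<open>c\<close>.\<close>

lemma transitive': "(a, b, c) \<in> S \<Longrightarrow> (a, c, d) \<in> S \<Longrightarrow> (b, c, d) \<in> S"
  by (rule cyclic'[OF transitive[OF cyclic cyclic']])

lemma total:
  "a \<in> Y \<Longrightarrow> b \<in> Y \<Longrightarrow> c \<in> Y \<Longrightarrow> a \<noteq> b \<Longrightarrow> b \<noteq> c \<Longrightarrow> a \<noteq> c \<Longrightarrow> (a, b, c) \<in> S \<or> (a, c, b) \<in> S"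
  using axioms[THEN conjunct2, THEN conjunct2, THEN conjunct2, THEN conjunct2] by simp

text \<open>A triple with two equal entries can be rotated so that its first and last entries agree.
  It is then its own reversal, against asymmetry.\<close>

lemma distinct: "(a, b, c) \<in> S \<Longrightarrow> a \<noteq> b \<and> b \<noteq> c \<and> a \<noteq> c"
  using asymmetric[of a b c] asymmetric[of b c a] asymmetric[of c a b] cyclic[of a b c] cyclic'[of a b c]
  by blast

section \<open>Separation of points in the interval topology\<close>

lemma openin_complement:
  assumes "a \<in> Y" "b \<in> Y"
  shows "openin (circ_topology Y S) (Y - circ_closed_interval Y S a b)"
  unfolding openin_circ_topology[OF circular_order]
  by (rule arbitrary_union_of_inc) (use assms in \<open>auto simp: circ_base_def\<close>)

text \<open>By totality, an open arc with distinct endpoints is the complement of the opposite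
  closed arc, hence a basic open set.\<close>

lemma openin_arc:
  assumes "a \<in> Y" "b \<in> Y" "a \<noteq> b"
  shows "openin (circ_topology Y S) (circ_open_interval Y S a b)"
proof -
  have "(a, x, b) \<in> S \<longleftrightarrow> x \<noteq> a \<and> x \<noteq> b \<and> (b, x, a) \<notin> S" if "x \<in> Y" for x
    using total[of a x b] asymmetric[of a x b] distinct[of a x b] cyclic'[of a b x] cyclic'[of b x a] cyclic[of a b x]
      that assms by blast
  then have "circ_open_interval Y S a b = Y - circ_closed_interval Y S b a"
    by (auto simp: circ_closed_interval_def circ_open_interval_def)
  then show ?thesis
    using openin_complement assms by simp
qed

text \<open>Cutting the circle at \<open>t\<close> makes \<open>(t, u, v) \<in> S\<close> a strict
  linear order "u before v" on the remaining points. The lemma says that this order is open, and the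
  neighbourhoods are rays of it.\<close>

lemma separate_with_cut:
  assumes "(t, p, q) \<in> S"
  obtains U V where "openin (circ_topology Y S) U" "openin (circ_topology Y S) V" "p \<in> U" "q \<in> V"
    "\<And>u v. u \<in> U \<Longrightarrow> v \<in> V \<Longrightarrow> (t, u, v) \<in> S"
proof -
  note tpq = in_carrier[OF assms] distinct[OF assms]
  show ?thesis
  \<comment> \<open>A point \<open>c\<close> between \<open>p\<close> and \<open>q\<close> bounds
    both rays. Without one, the pair is a jump and the rays end at \<open>q\<close> and
    \<open>p\<close> themselves.\<close>
  proof (cases "\<exists>c. (p, c, q) \<in> S")
    case True
    then obtain c where c: "(p, c, q) \<in> S" by blast
    have tc: "(t, p, c) \<in> S" "(t, c, q) \<in> S"
      using cyclic'[OF transitive[OF c cyclic[OF assms]]] cyclic'[OF transitive'[OF c cyclic[OF assms]]]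
      by auto
    show ?thesis
    proof (rule that)
      show "openin (circ_topology Y S) (circ_open_interval Y S t c)"
        "openin (circ_topology Y S) (circ_open_interval Y S c t)"
        using openin_arc in_carrier[OF tc(1)] distinct[OF tc(1)] by auto
      show "p \<in> circ_open_interval Y S t c" "q \<in> circ_open_interval Y S c t"
        using tc(1) cyclic[OF tc(2)] tpq by (auto simp: circ_open_interval_def)
      show "(t, u, v) \<in> S"
        if "u \<in> circ_open_interval Y S t c" "v \<in> circ_open_interval Y S c t" for u v
        using that transitive[of t u c v] cyclic'[of c v t] unfolding circ_open_interval_def by blast
    qed
  next
    case False
    show ?thesis
    proof (rule that)
      show "openin (circ_topology Y S) (circ_open_interval Y S t q)"
        "openin (circ_topology Y S) (circ_open_interval Y S p t)"
        using openin_arc tpq by auto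
      show "p \<in> circ_open_interval Y S t q" "q \<in> circ_open_interval Y S p t"
        using assms cyclic[OF assms] tpq by (auto simp: circ_open_interval_def)
      show "(t, u, v) \<in> S"
        if u: "u \<in> circ_open_interval Y S t q" and v: "v \<in> circ_open_interval Y S p t" for u v
      proof -
        have u': "u \<in> Y" "(t, u, q) \<in> S" and v': "(t, p, v) \<in> S"
          using u v cyclic'[of p v t] by (auto simp: circ_open_interval_def)
        \<comment> \<open>Since nothing lies strictly between \<open>p\<close> and \<open>q\<close>,
          every point before \<open>q\<close> is at or before \<open>p\<close>.\<close>
        have "u = p \<or> (t, u, p) \<in> S"
        proof (rule ccontr)
          assume "\<not> ?thesis"
          then have "(t, p, u) \<in> S"
            using total[of t u p] u' tpq distinct[OF u'(2)] by blast
          then have "(p, u, q) \<in> S"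
            using u'(2) by (rule transitive')
          then show False
            using False by blast
        qed
        then show ?thesis
          using v' transitive[of t u p v] by blast
      qed
    qed
  qed
qed

text \<open>\<open>separate_with_cut\<close> moves two points while the third stays fixed. Using
  each of \<open>p\<close>, \<open>q\<close>, \<open>r\<close> as the cut and intersecting the
  neighbourhoods controls all three moving points: a reversed triple \<open>u\<close>,
  \<open>v\<close>, \<open>w\<close> would force \<open>p\<close>, \<open>q\<close>,
  \<open>r\<close> to be reversed too.\<close>

lemma relation_open:
  assumes "(p, q, r) \<in> S"
  obtains U V W where "openin (circ_topology Y S) U" "openin (circ_topology Y S) V"
    "openin (circ_topology Y S) W" "p \<in> U" "q \<in> V" "r \<in> W"
    "\<And>u v w. u \<in> U \<Longrightarrow> v \<in> V \<Longrightarrow> w \<in> W \<Longrightarrow> (u, v, w) \<in> S"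
proof -
  have rot: "(q, r, p) \<in> S" "(r, p, q) \<in> S"
    using cyclic[OF assms] cyclic'[OF assms] by auto
  obtain U1 V1 where 1: "openin (circ_topology Y S) U1" "openin (circ_topology Y S) V1"
    "p \<in> U1" "q \<in> V1" "\<And>u v. u \<in> U1 \<Longrightarrow> v \<in> V1 \<Longrightarrow> (r, u, v) \<in> S"
    using separate_with_cut[OF rot(2)] by metis
  obtain V2 W2 where 2: "openin (circ_topology Y S) V2" "openin (circ_topology Y S) W2"
    "q \<in> V2" "r \<in> W2" "\<And>v w. v \<in> V2 \<Longrightarrow> w \<in> W2 \<Longrightarrow> (p, v, w) \<in> S"
    using separate_with_cut[OF assms] by metis
  obtain W3 U3 where 3: "openin (circ_topology Y S) W3" "openin (circ_topology Y S) U3"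
    "r \<in> W3" "p \<in> U3" "\<And>w u. w \<in> W3 \<Longrightarrow> u \<in> U3 \<Longrightarrow> (q, w, u) \<in> S"
    using separate_with_cut[OF rot(1)] by metis
  show ?thesis
  proof (rule that)
    show "openin (circ_topology Y S) (U1 \<inter> U3)" "openin (circ_topology Y S) (V1 \<inter> V2)"
      "openin (circ_topology Y S) (W2 \<inter> W3)"
      using 1 2 3 by auto
    show "p \<in> U1 \<inter> U3" "q \<in> V1 \<inter> V2" "r \<in> W2 \<inter> W3"
      using 1 2 3 by auto
    fix u v w
    assume uvw: "u \<in> U1 \<inter> U3" "v \<in> V1 \<inter> V2" "w \<in> W2 \<inter> W3"
    have s: "(r, u, v) \<in> S" "(p, v, w) \<in> S" "(q, w, u) \<in> S"
      using uvw 1(5) 2(5) 3(5) by auto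
    show "(u, v, w) \<in> S"
    proof (rule ccontr)
      assume "(u, v, w) \<notin> S"
      then have a: "(u, w, v) \<in> S"
        using total[of u v w] in_carrier[OF s(1)] in_carrier[OF s(2)]
          distinct[OF s(1)] distinct[OF s(2)] distinct[OF s(3)] by blast
      \<comment> \<open>The points occur in the order u, q, w, p, v, r on the circle, which reverses p, q, r.\<close>
      have "(w, v, q) \<in> S"
        using transitive[OF cyclic[OF a] cyclic[OF s(3)]] .
      then have qpv: "(q, p, v) \<in> S"
        using cyclic'[OF transitive'[OF cyclic'[OF s(2)]]] by blast
      have "(u, q, v) \<in> S"
        using transitive[OF cyclic'[OF s(3)] a] .
      then have "(q, v, r) \<in> S"
        using transitive'[OF _ cyclic[OF s(1)]] by blast
      then have "(q, p, r) \<in> S"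
        using transitive[OF qpv] by blast
      then show False
        using asymmetric[OF rot(2)] by blast
    qed
  qed
qed

text \<open>The last clause says that points of \<open>V\<close> never lie on both arcs between two
  points of \<open>U\<close>. Once the circle is cut at a third point, one of \<open>U\<close>,
  \<open>V\<close> lies entirely before the other, so all of \<open>V\<close> is on the arc through
  the cut.\<close>

lemma separate_two:
  assumes "p \<in> Y" "q \<in> Y" "p \<noteq> q"
  obtains U V where "openin (circ_topology Y S) U" "openin (circ_topology Y S) V" "p \<in> U" "q \<in> V"
    "U \<inter> V = {}"
    "\<And>u u' v v'. u \<in> U \<Longrightarrow> u' \<in> U \<Longrightarrow> v \<in> V \<Longrightarrow> v' \<in> V \<Longrightarrow> (u, v, u') \<in> S \<Longrightarrow> (u', v', u) \<notin> S"
proof (cases "\<exists>t\<in>Y. t \<noteq> p \<and> t \<noteq> q")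
  case True
  then obtain t where t: "t \<in> Y" "t \<noteq> p" "t \<noteq> q" by blast
  then consider "(t, p, q) \<in> S" | "(t, q, p) \<in> S"
    using total[of t p q] assms by blast
  then show ?thesis
  proof cases
    case 1
    obtain U V where UV: "openin (circ_topology Y S) U" "openin (circ_topology Y S) V" "p \<in> U" "q \<in> V"
      and sep: "\<And>u v. u \<in> U \<Longrightarrow> v \<in> V \<Longrightarrow> (t, u, v) \<in> S"
      using separate_with_cut[OF 1] by metis
    have "(u', v', u) \<notin> S"
      if "u \<in> U" "u' \<in> U" "v \<in> V" "v' \<in> V" "(u, v, u') \<in> S" for u u' v v'
    proof
      assume a: "(u', v', u) \<in> S"
      have s: "(t, u, v') \<in> S" "(t, u', v) \<in> S"
        using sep that by auto
      \<comment> \<open>Whichever of \<open>u\<close>, \<open>u'\<close> comes first, both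
        \<open>v\<close> and \<open>v'\<close> come after the two of them, so they share an
        arc.\<close>
      have "(t, u, u') \<in> S \<or> (t, u', u) \<in> S"
        using total[of t u u'] t(1) in_carrier[OF a] distinct[OF a]
          distinct[OF s(1)] distinct[OF s(2)] by blast
      then show False
        using cyclic[OF transitive'[OF _ s(2)]] cyclic[OF transitive'[OF _ s(1)]]
          asymmetric[OF a] asymmetric[OF that(5)] by blast
    qed
    moreover have "U \<inter> V = {}"
      using sep distinct by blast
    ultimately show ?thesis
      using that UV by blast
  next
    case 2
    obtain V U where UV: "openin (circ_topology Y S) V" "openin (circ_topology Y S) U" "q \<in> V" "p \<in> U"
      and sep: "\<And>v u. v \<in> V \<Longrightarrow> u \<in> U \<Longrightarrow> (t, v, u) \<in> S"
      using separate_with_cut[OF 2] by metis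
    have "(u', v', u) \<notin> S"
      if "u \<in> U" "u' \<in> U" "v \<in> V" "v' \<in> V" "(u, v, u') \<in> S" for u u' v v'
    proof
      assume a: "(u', v', u) \<in> S"
      have s: "(t, v, u) \<in> S" "(t, v', u') \<in> S"
        using sep that by auto
      have "(t, u, u') \<in> S \<or> (t, u', u) \<in> S"
        using total[of t u u'] t(1) in_carrier[OF a] distinct[OF a]
          distinct[OF s(1)] distinct[OF s(2)] by blast
      then show False
        using cyclic'[OF transitive'[OF s(1)]] cyclic'[OF transitive'[OF s(2)]]
          asymmetric[OF a] asymmetric[OF that(5)] by blast
    qed
    moreover have "U \<inter> V = {}"
      using sep distinct by blast
    ultimately show ?thesis
      using that UV by blast
  qed
next
  case False
  then have Y: "Y = {p, q}"
    using assms by blast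
  \<comment> \<open>With only two points no cut is available, but degenerate intervals make each
    singleton open. Then \<open>u = u'\<close>, which \<open>distinct\<close> excludes.\<close>
  have "circ_closed_interval Y S a a = {a}" for a
    using distinct by (auto simp: circ_closed_interval_def circ_open_interval_def)
  then have "openin (circ_topology Y S) {p}" "openin (circ_topology Y S) {q}"
    using openin_complement[OF assms(2,2)] openin_complement[OF assms(1,1)] Y assms(3)
    by (auto simp: insert_Diff_if)
  then show ?thesis
    using that[of "{p}" "{q}"] assms(3) distinct by blast
qed

text \<open>This is the form needed for a failure of COP2: \<open>p\<close> is the common value at
  the ends, \<open>q\<close> and \<open>r\<close> are the values at the witnesses in the two arcs.
  These two values may coincide, hence the case split.\<close>

lemma separate_from_two:
  assumes "p \<in> Y" "q \<in> Y" "r \<in> Y" "p \<noteq> q" "p \<noteq> r"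
  obtains U V W where "openin (circ_topology Y S) U" "openin (circ_topology Y S) V"
    "openin (circ_topology Y S) W" "p \<in> U" "q \<in> V" "r \<in> W" "U \<inter> V = {}" "U \<inter> W = {}"
    "\<And>u u' v w. u \<in> U \<Longrightarrow> u' \<in> U \<Longrightarrow> v \<in> V \<Longrightarrow> w \<in> W \<Longrightarrow> (u, v, u') \<in> S \<Longrightarrow> (u', w, u) \<notin> S"
proof (cases "q = r")
  case True
  then show ?thesis
    using separate_two[OF assms(1,2,4)] that by metis
next
  case False
  then consider "(p, q, r) \<in> S" | "(p, r, q) \<in> S"
    using total assms by blast
  then show ?thesis
  proof cases
    case 1
    obtain U V W where UVW: "openin (circ_topology Y S) U" "openin (circ_topology Y S) V"
      "openin (circ_topology Y S) W" "p \<in> U" "q \<in> V" "r \<in> W"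
      and s: "\<And>u v w. u \<in> U \<Longrightarrow> v \<in> V \<Longrightarrow> w \<in> W \<Longrightarrow> (u, v, w) \<in> S"
      using relation_open[OF 1] by metis
    \<comment> \<open>Otherwise the cyclic order is \<open>u\<close>, \<open>v\<close>,
      \<open>u'\<close>, \<open>w\<close>. Read from \<open>u'\<close> it puts \<open>w\<close>
      before \<open>v\<close>, against \<open>s\<close> at \<open>u'\<close>.\<close>
    have "(u', w, u) \<notin> S"
      if "u \<in> U" "u' \<in> U" "v \<in> V" "w \<in> W" "(u, v, u') \<in> S" for u u' v w
      using asymmetric[OF transitive'[OF that(5) cyclic']] cyclic'[OF s[OF that(2,3,4)]] by blast
    moreover have "U \<inter> V = {}" "U \<inter> W = {}"
      using s distinct UVW by blast+
    ultimately show ?thesis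
      using that UVW by blast
  next
    case 2
    obtain U W V where UVW: "openin (circ_topology Y S) U" "openin (circ_topology Y S) W"
      "openin (circ_topology Y S) V" "p \<in> U" "r \<in> W" "q \<in> V"
      and s: "\<And>u w v. u \<in> U \<Longrightarrow> w \<in> W \<Longrightarrow> v \<in> V \<Longrightarrow> (u, w, v) \<in> S"
      using relation_open[OF 2] by metis
    \<comment> \<open>The same cyclic order, now read from \<open>u\<close>, puts \<open>v\<close>
      before \<open>w\<close>, against \<open>s\<close> at \<open>u\<close>.\<close>
    have "(u', w, u) \<notin> S"
      if "u \<in> U" "u' \<in> U" "v \<in> V" "w \<in> W" "(u, v, u') \<in> S" for u u' v w
      using asymmetric[OF transitive[OF that(5) cyclic']] cyclic[OF s[OF that(1,4,3)]] by blast
    moreover have "U \<inter> V = {}" "U \<inter> W = {}"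
      using s distinct UVW by blast+
    ultimately show ?thesis
      using that UVW by blast
  qed
qed

end

section \<open>Closedness of the set of COP maps in the product\<close>

lemma openin_product_evaluation:
  assumes "openin T U" "x \<in> X"
  shows "openin (product_topology (\<lambda>_. T) X) {g \<in> X \<rightarrow>\<^sub>E topspace T. g x \<in> U}"
  using openin_continuous_map_preimage[OF continuous_map_product_projection[OF assms(2), of "\<lambda>_. T"] assms(1)]
  by simp

lemma COP_maps_preserving:
  assumes "f \<in> COP_maps X R Y S" "(a, b, c) \<in> R" "f a \<noteq> f b" "f b \<noteq> f c" "f a \<noteq> f c"
  shows "(f a, f b, f c) \<in> S"
  using assms by (simp add: COP_maps_def)

lemma COP_maps_constant:
  assumes "f \<in> COP_maps X R Y S" "x \<in> X" "y \<in> X" "f x = f y"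
  shows "f constant_on circ_closed_interval X R x y \<or> f constant_on circ_closed_interval X R y x"
  using assms by (simp add: COP_maps_def)

theorem theorem4p5:
  fixes X :: "'a set" and R :: "('a \<times> 'a \<times> 'a) set"
    and Y :: "'b set" and S :: "('b \<times> 'b \<times> 'b) set"
  assumes "circular_order_on X R" and "circular_order_on Y S"
  shows "closedin (product_topology (\<lambda>_. circ_topology Y S) X) (COP_maps X R Y S)"
proof -
  let ?P = "product_topology (\<lambda>_. circ_topology Y S) X"
  let ?C = "COP_maps X R Y S"
  interpret X: circular_order X R by unfold_locales (fact assms(1))
  interpret Y: circular_order Y S by unfold_locales (fact assms(2))
  have top: "topspace ?P = X \<rightarrow>\<^sub>E Y"
    by (simp add: topspace_circ_topology[OF assms(2)])
  define E where "E x U = {g \<in> X \<rightarrow>\<^sub>E Y. g x \<in> U}" for x U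
  have E: "openin ?P (E x U)" if "openin (circ_topology Y S) U" "x \<in> X" for x U
    using openin_product_evaluation[OF that] by (simp add: E_def topspace_circ_topology[OF assms(2)])
  have "\<exists>N. openin ?P N \<and> f \<in> N \<and> N \<subseteq> (X \<rightarrow>\<^sub>E Y) - ?C" if f: "f \<in> X \<rightarrow>\<^sub>E Y" "f \<notin> ?C" for f
  proof -
    have fY: "f x \<in> Y" if "x \<in> X" for x
      using f(1) that by blast
    consider
      (cop1) a b c where "(a, b, c) \<in> R" "f a \<noteq> f b" "f b \<noteq> f c" "f a \<noteq> f c" "(f a, f b, f c) \<notin> S"
    | (cop2) x y where "x \<in> X" "y \<in> X" "f x = f y"
        "\<not> f constant_on circ_closed_interval X R x y" "\<not> f constant_on circ_closed_interval X R y x"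
      using f unfolding COP_maps_def by blast
    then show ?thesis
    proof cases
      case cop1
      have abc: "a \<in> X" "b \<in> X" "c \<in> X"
        using X.in_carrier[OF cop1(1)] by auto
      have "(f a, f c, f b) \<in> S"
        using Y.total[of "f a" "f b" "f c"] fY abc cop1 by blast
      then obtain U W V where o: "openin (circ_topology Y S) U" "openin (circ_topology Y S) W"
        "openin (circ_topology Y S) V" and m: "f a \<in> U" "f c \<in> W" "f b \<in> V"
        and s: "\<And>u w v. u \<in> U \<Longrightarrow> w \<in> W \<Longrightarrow> v \<in> V \<Longrightarrow> (u, w, v) \<in> S"
        using Y.relation_open by metis
      have "g \<notin> ?C" if "g \<in> E a U \<inter> E b V \<inter> E c W" for g
      proof
        assume "g \<in> ?C"
        have g: "(g a, g c, g b) \<in> S"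
          using that s by (auto simp: E_def)
        then have "(g a, g b, g c) \<in> S"
          using COP_maps_preserving[OF \<open>g \<in> ?C\<close> cop1(1)] Y.distinct[OF g] by metis
        then show False
          using Y.asymmetric Y.cyclic[OF g] by blast
      qed
      then have "E a U \<inter> E b V \<inter> E c W \<subseteq> (X \<rightarrow>\<^sub>E Y) - ?C"
        by (auto simp: E_def)
      moreover have "openin ?P (E a U \<inter> E b V \<inter> E c W)"
        using E o abc by blast
      moreover have "f \<in> E a U \<inter> E b V \<inter> E c W"
        using f m by (auto simp: E_def)
      ultimately show ?thesis
        by blast
    next
      case cop2
      \<comment> \<open>Both endpoints carry the value \<open>f x\<close>, so a point where
        constancy fails is interior to its arc.\<close>
      have "\<exists>z. (x, z, y) \<in> R \<and> f z \<noteq> f x" "\<exists>w. (y, w, x) \<in> R \<and> f w \<noteq> f x"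
        using cop2 unfolding constant_on_def circ_closed_interval_def circ_open_interval_def
        by (metis (no_types, lifting) Un_iff insert_iff empty_iff mem_Collect_eq)+
      then obtain z w where zw: "(x, z, y) \<in> R" "(y, w, x) \<in> R" "f z \<noteq> f x" "f w \<noteq> f x"
        by blast
      have X: "z \<in> X" "w \<in> X"
        using X.in_carrier zw by blast+
      obtain U V W where o: "openin (circ_topology Y S) U" "openin (circ_topology Y S) V"
        "openin (circ_topology Y S) W" and m: "f x \<in> U" "f z \<in> V" "f w \<in> W"
        and d: "U \<inter> V = {}" "U \<inter> W = {}"
        and s: "\<And>u u' v w. u \<in> U \<Longrightarrow> u' \<in> U \<Longrightarrow> v \<in> V \<Longrightarrow> w \<in> W \<Longrightarrow>
          (u, v, u') \<in> S \<Longrightarrow> (u', w, u) \<notin> S"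
        using Y.separate_from_two[of "f x" "f z" "f w"] fY X zw cop2(1) by metis
      \<comment> \<open>The same \<open>U\<close> constrains the values at \<open>x\<close> and
        \<open>y\<close>, because \<open>f x = f y\<close>.\<close>
      let ?N = "E x U \<inter> E y U \<inter> E z V \<inter> E w W"
      have "g \<notin> ?C" if "g \<in> ?N" for g
      proof
        assume g: "g \<in> ?C"
        have gm: "g x \<in> U" "g y \<in> U" "g z \<in> V" "g w \<in> W"
          using that by (auto simp: E_def)
        then have ne: "g x \<noteq> g z" "g y \<noteq> g z" "g x \<noteq> g w" "g y \<noteq> g w"
          using d by auto
        show False
        \<comment> \<open>A nearby \<open>g\<close> may or may not keep the two values equal.
          Equality contradicts COP2 by disjointness of \<open>U\<close> from \<open>V\<close> and
          \<open>W\<close>; inequality makes COP1 applicable on both arcs, which \<open>s\<close>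
          forbids.\<close>
        proof (cases "g x = g y")
          case True
          then have "g constant_on circ_closed_interval X R x y \<or> g constant_on circ_closed_interval X R y x"
            using COP_maps_constant[OF g cop2(1,2)] by blast
          moreover have "z \<in> circ_closed_interval X R x y" "w \<in> circ_closed_interval X R y x"
            "x \<in> circ_closed_interval X R x y" "x \<in> circ_closed_interval X R y x"
            using zw X by (auto simp: circ_closed_interval_def circ_open_interval_def)
          ultimately show False
            using ne unfolding constant_on_def by metis
        next
          case False
          then have "(g x, g z, g y) \<in> S" "(g y, g w, g x) \<in> S"
            using COP_maps_preserving[OF g zw(1)] COP_maps_preserving[OF g zw(2)] ne by metis+
          then show False
            using s gm by blast
        qed
      qed
      then have "?N \<subseteq> (X \<rightarrow>\<^sub>E Y) - ?C"
        by (auto simp: E_def)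
      moreover have "openin ?P ?N"
        using E o X cop2(1,2) by blast
      moreover have "f \<in> ?N"
        using f m cop2(3) by (auto simp: E_def)
      ultimately show ?thesis
        by blast
    qed
  qed
  then have "openin ?P ((X \<rightarrow>\<^sub>E Y) - ?C)"
    by (subst openin_subopen) blast
  moreover have "?C \<subseteq> X \<rightarrow>\<^sub>E Y"
    by (auto simp: COP_maps_def)
  ultimately show ?thesis
    unfolding closedin_def top by blast
qed

end
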